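(* Let $k\ge 2$, $J>0$, $\beta>0$ and put $\theta=\exp(\beta J/2)$. Consider the triple mixed-spin Ising model with spin values $(\tfrac12,1,\tfrac32)$ on the Cayley tree $\Gamma^k$ of order $k$, with the spin sets $\Psi,\Phi,\Upsilon$ arranged periodically with period three along the generations. Let $f(\cdot,\theta,k):(0,\infty)\to(0,\infty)$ be the scalar map defined in the context, and set $s_k(\theta)=f'(1,\theta,k)-1$, where $'$ denotes the derivative in the first variable. If $s_k(\theta)>0$, then the fixed-point equation $x=f(x,\theta,k)$ admits at least three distinct positive solutions. Consequently, for every such pair $(\theta,k)$ the model admits at least three distinct translation-invariant splitting Gibbs measures.
   Context: Tree. $\Gamma^k=(V,L)$ is the semi-infinite Cayley tree of order $k$: an infinite tree with root $x^{(0)}$ in which the root has exactly $k$ edges and every other vertex has exactly $k+1$ edges. $d$ is graph distance, $W_n=\{x: d(x,x^{(0)})=n\}$, $V_n=\bigcup_{m=0}^n W_m$, $L_n$ is the set of edges with both endpoints in $V_n$, and $\Gamma_i^k=\{x\in V: d(x^{(0)},x)\equiv i \pmod 3\}$ for $i=0,1,2$. Model. $\Psi=\{-\tfrac12,\tfrac12\}$, $\Phi=\{-1,0,1\}$, $\Upsilon=\{-\tfrac32,-\tfrac12,\tfrac12,\tfrac32\}$. The spin set $S_x$ of a vertex $x$ is $\Psi$, $\Phi$ or $\Upsilon$ according to whether $x\in\Gamma_0^k$, $\Gamma_1^k$ or $\Gamma_2^k$. Configurations are $\xi\in\Xi=\prod_{x\in V}S_x$, and $\Xi_n=\prod_{x\in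 V_n}S_x$. The Hamiltonian is $H(\xi)=-J\sum_{\langle x,y\rangle\in L}\xi(x)\xi(y)$, and $H_n(\xi)=-J\sum_{\langle x,y\rangle\in L_n}\xi(x)\xi(y)$ for $\xi\in\Xi_n$. Splitting Gibbs measures. Given a family of real vectors $h_x=(h_{s,x})_{s\in S_x}$, $x\in V$, define for $n\ge1$ the probability measure on $\Xi_n$ $$\mu_n^h(\xi)=\frac1{Z_n}\exp\Big\{-\beta H_n(\xi)+\sum_{x\in W_n}h_{\xi(x),x}\Big\}.$$ The sequence is compatible if $\sum_{\omega\in\prod_{x\in W_n}S_x}\mu_n^h(\xi_{n-1}\vee\omega)=\mu_{n-1}^h(\xi_{n-1})$ for all $n\ge1$ and $\xi_{n-1}\in\Xi_{n-1}$ ($\vee$ denotes concatenation). Then there is a unique probability measure $\mu$ on $\Xi$ whose marginal on each $V_n$ is $\mu_n^h$; it is called a splitting Gibbs measure (SGM). Put $X_x=e^{h_{1/2,x}-h_{-1/2,x}}$ for $x\in\Gamma_0^k$; $Y_x=e^{h_{-1,x}-h_{0,x}}$, $Z_x=e^{h_{1,x}-h_{0,x}}$ for $x\in\Gamma_1^k$; $T_x=e^{h_{-3/2,x}-h_{-1/2,x}}$, $U_x=e^{h_{1/2,x}-h_{-1/2,x}}$, $N_x=e^{h_{3/2,x}-h_{-1/2,x}}$ for $x\in\Gamma_2^k$. An SGM is translation-invariant (a TISGM) if it comes from a compatible family $h$ for which these quantities are constants $X,Y,Z,T,U,N>0$ not depending on $x$; by the standard compatibility criterion such constants are exactly the positive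 solutions of $$X=\Big(\tfrac{Y+\theta+\theta^2Z}{\theta^2Y+\theta+Z}\Big)^k,\quad Y=\Big(\tfrac{\theta^6T+\theta^4+\theta^2U+N}{\theta^3(T+1+U+N)}\Big)^k,\quad Z=\Big(\tfrac{T+\theta^2+\theta^4U+\theta^6N}{\theta^3(T+1+U+N)}\Big)^k,$$ $$T=\Big(\tfrac{X+\theta^3}{\theta^2+\theta X}\Big)^k,\quad U=\Big(\tfrac{\theta X+1}{X+\theta}\Big)^k,\quad N=\Big(\tfrac{\theta^3X+1}{\theta^2+\theta X}\Big)^k.$$ Scalar map. For $x>0$ let $$T(x)=\Big(\tfrac{x^k+\theta^3}{\theta^2+\theta x^k}\Big)^k,\quad U(x)=\Big(\tfrac{\theta x^k+1}{x^k+\theta}\Big)^k,\quad N(x)=\Big(\tfrac{\theta^3x^k+1}{\theta^2+\theta x^k}\Big)^k,$$ $$p(x,\theta,k)=\Big(\tfrac{\theta^6T(x)+\theta^4+\theta^2U(x)+N(x)}{\theta^3(T(x)+1+U(x)+N(x))}\Big)^k,\quad q(x,\theta,k)=\Big(\tfrac{T(x)+\theta^2+\theta^4U(x)+\theta^6N(x)}{\theta^3(T(x)+1+U(x)+N(x))}\Big)^k,$$ $$f(x,\theta,k)=\frac{p(x,\theta,k)+\theta+\theta^2q(x,\theta,k)}{\theta^2p(x,\theta,k)+\theta+q(x,\theta,k)}.$$ A positive solution of $x=f(x,\theta,k)$ corresponds to the constant solution with $X=x^k$, $T=T(x)$, $U=U(x)$, $N=N(x)$, $Y=p(x,\theta,k)$,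 $Z=q(x,\theta,k)$ of the system above. *)

theory Defs
  imports "HOL-Probability.Probability"
begin

section \<open>The semi-infinite Cayley tree\<close>

text \<open>A vertex is the list of child indices on the path leading to it, latest step first. The root is
  \<open>[]\<close> and the \<open>k\<close> children of \<open>x\<close> are \<open>i # x\<close> for \<open>i < k\<close>.\<close>

definition tree_verts :: "nat \<Rightarrow> nat list set" where
  "tree_verts k = lists {..<k}"

definition tree_edges :: "nat \<Rightarrow> nat list set set" where
  "tree_edges k = {{x, i # x} | x i. x \<in> tree_verts k \<and> i < k}"

definition tree_dist :: "nat \<Rightarrow> nat list \<Rightarrow> nat list \<Rightarrow> nat" where
  "tree_dist k x y = (LEAST n. (x, y) \<in> {(u, v). {u, v} \<in> tree_edges k} ^^ n)"

definition sphere_verts :: "nat \<Rightarrow> nat \<Rightarrow> nat list set" where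
  "sphere_verts k n = {x \<in> tree_verts k. tree_dist k x [] = n}"

definition ball_verts :: "nat \<Rightarrow> nat \<Rightarrow> nat list set" where
  "ball_verts k n = (\<Union>m\<le>n. sphere_verts k m)"

definition ball_edges :: "nat \<Rightarrow> nat \<Rightarrow> nat list set set" where
  "ball_edges k n = {e \<in> tree_edges k. e \<subseteq> ball_verts k n}"

definition gen_class :: "nat \<Rightarrow> nat \<Rightarrow> nat list set" where
  "gen_class k i = {x \<in> tree_verts k. tree_dist k [] x mod 3 = i}"

lemma tree_edge_iff:
  "{u, v} \<in> tree_edges k \<longleftrightarrow>
     u \<in> tree_verts k \<and> v \<in> tree_verts k \<and> ((\<exists>i. v = i # u) \<or> (\<exists>i. u = i # v))"
  (is "?l \<longleftrightarrow> ?r")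
proof
  show "?l \<Longrightarrow> ?r" by (auto simp: tree_edges_def tree_verts_def doubleton_eq_iff)
next
  have edge: "{x, y} \<in> tree_edges k" if "x \<in> tree_verts k" "y \<in> tree_verts k" "y = i # x" for x y i
    using that unfolding tree_edges_def by (auto simp: tree_verts_def)
  show "?r \<Longrightarrow> ?l" using edge[of u v] edge[of v u] by (auto simp: insert_commute)
qed

lemma root_edges: "card {e \<in> tree_edges k. [] \<in> e} = k"
proof -
  have "{e \<in> tree_edges k. [] \<in> e} = (\<lambda>i. {[], [i]}) ` {..<k}"
    by (auto simp: tree_edges_def tree_verts_def)
  moreover have "inj_on (\<lambda>i. {[], [i]}) {..<k}"
    by (auto simp: inj_on_def doubleton_eq_iff)
  ultimately show ?thesis by (simp add: card_image)
qed

lemma nonroot_edges: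
  assumes "x \<in> tree_verts k" "x \<noteq> []"
  shows "card {e \<in> tree_edges k. x \<in> e} = k + 1"
proof -
  have x: "x = hd x # tl x" using assms by simp
  have "{e \<in> tree_edges k. x \<in> e} = insert {tl x, x} ((\<lambda>i. {x, i # x}) ` {..<k})" (is "?A = ?B")
  proof
    show "?A \<subseteq> ?B" by (auto simp: tree_edges_def tree_verts_def)
    have "{tl x, x} \<in> tree_edges k"
      using assms x by (cases x) (auto simp: tree_edge_iff tree_verts_def)
    then show "?B \<subseteq> ?A" using assms(1) by (auto simp: tree_edges_def)
  qed
  moreover have "inj_on (\<lambda>i. {x, i # x}) {..<k}"
    by (auto simp: inj_on_def doubleton_eq_iff)
  moreover have "{tl x, x} \<notin> (\<lambda>i. {x, i # x}) ` {..<k}"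
  proof
    assume "{tl x, x} \<in> (\<lambda>i. {x, i # x}) ` {..<k}"
    then obtain i where "{tl x, x} = {x, i # x}" by auto
    then have "tl x = i # x" by (auto simp: doubleton_eq_iff)
    then have "length (tl x) = Suc (length x)" by simp
    then show False by simp
  qed
  ultimately show ?thesis by (simp add: card_image)
qed

lemma tree_no_cycle:
  assumes "distinct p" "length p \<ge> 3" "successively (\<lambda>u v. {u, v} \<in> tree_edges k) p"
  shows "{last p, hd p} \<notin> tree_edges k"
proof
  assume closed: "{last p, hd p} \<in> tree_edges k"
  define n where "n = length p"
  have n: "n \<ge> 3" using assms by (simp add: n_def)
  have adj: "{p ! i, p ! (Suc i mod n)} \<in> tree_edges k" if "i < n" for i
  proof (cases "Suc i = n")
    case True
    have "p \<noteq> []" using n by (auto simp: n_def)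
    then have "last p = p ! i" "hd p = p ! 0"
      using arg_cong[OF True, of "\<lambda>m. m - 1"]
      by (simp_all add: last_conv_nth hd_conv_nth flip: n_def)
    with True closed show ?thesis by simp
  next
    case False
    then have "Suc i < n" using that by simp
    then show ?thesis using assms(3) by (simp add: successively_conv_nth n_def)
  qed
  have up: "v = tl u" if "{u, v} \<in> tree_edges k" "length v \<le> length u" for u v
    using that by (auto simp: tree_edge_iff)
  have "finite {..<n}" "{..<n} \<noteq> {}" using n by (auto simp: lessThan_empty_iff)
  then obtain i where i: "i < n" and
    mx: "\<And>j. j < n \<Longrightarrow> length (p ! j) \<le> length (p ! i)"
    using obtains_MAX[of "{..<n}" "\<lambda>j. length (p ! j)"]
    by (metis Max_ge finite_imageI image_eqI lessThan_iff)
  define a where "a = Suc i mod n"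
  define b where "b = (if i = 0 then n - 1 else i - 1)"
  have ab: "a < n" "b < n" "Suc b mod n = i" "a \<noteq> b"
    using i n by (auto simp: a_def b_def mod_Suc)
  have "p ! a = tl (p ! i)" using up[OF adj[OF i]] mx[OF ab(1)] by (simp add: a_def)
  moreover have "p ! b = tl (p ! i)"
    using up[of "p ! i" "p ! b"] adj[OF ab(2)] ab(3) mx[OF ab(2)] by (simp add: insert_commute)
  ultimately show False
    using nth_eq_iff_index_eq[OF assms(1), of a b] ab by (simp add: n_def)
qed

lemma tree_dist_commute: "tree_dist k x y = tree_dist k y x"
proof -
  have "(x, y) \<in> {(u, v). {u, v} \<in> tree_edges k} ^^ n"
    if "(y, x) \<in> {(u, v). {u, v} \<in> tree_edges k} ^^ n" for n x y
    using that
  proof (induction n arbitrary: x)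
    case (Suc n)
    then obtain z where "(y, z) \<in> {(u, v). {u, v} \<in> tree_edges k} ^^ n" "{z, x} \<in> tree_edges k"
      by auto
    then have "(x, z) \<in> {(u, v). {u, v} \<in> tree_edges k}"
      "(z, y) \<in> {(u, v). {u, v} \<in> tree_edges k} ^^ n"
      using Suc.IH by (auto simp: insert_commute)
    then show ?case by (rule relpow_Suc_I2)
  qed simp
  then have "\<And>n. (x, y) \<in> {(u, v). {u, v} \<in> tree_edges k} ^^ n \<longleftrightarrow>
      (y, x) \<in> {(u, v). {u, v} \<in> tree_edges k} ^^ n"
    by blast
  then show ?thesis by (simp only: tree_dist_def)
qed

lemma tree_dist_root:
  assumes "x \<in> tree_verts k"
  shows "tree_dist k [] x = length x"
  unfolding tree_dist_def
proof (rule Least_equality)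
  show "([], x) \<in> {(u, v). {u, v} \<in> tree_edges k} ^^ length x"
    using assms
  proof (induction x)
    case (Cons i x)
    then have "x \<in> tree_verts k" "{x, i # x} \<in> tree_edges k"
      by (auto simp: tree_verts_def tree_edges_def)
    with Cons.IH show ?case by auto
  qed simp
next
  fix n
  show "([], x) \<in> {(u, v). {u, v} \<in> tree_edges k} ^^ n \<Longrightarrow> length x \<le> n"
  proof (induction n arbitrary: x)
    case (Suc n)
    then obtain z where "([], z) \<in> {(u, v). {u, v} \<in> tree_edges k} ^^ n" "{z, x} \<in> tree_edges k"
      by auto
    with Suc.IH[of z] show ?case by (auto simp: tree_edge_iff)
  qed simp
qed

lemma sphere_verts_eq: "sphere_verts k n = {x \<in> tree_verts k. length x = n}"
  by (auto simp: sphere_verts_def tree_dist_root tree_dist_commute[of k _ "[]"])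

lemma gen_class_eq: "gen_class k i = {x \<in> tree_verts k. length x mod 3 = i}"
  by (auto simp: gen_class_def tree_dist_root)

lemma ball_verts_eq: "ball_verts k n = {x \<in> tree_verts k. length x \<le> n}"
  by (auto simp: ball_verts_def sphere_verts_eq)

lemma finite_sphere_verts [simp]: "finite (sphere_verts k n)"
  unfolding sphere_verts_eq tree_verts_def lists_eq_set using finite_lists_length_eq[of "{..<k}" n]
  by simp

lemma finite_ball_verts [simp]: "finite (ball_verts k n)"
  by (simp add: ball_verts_def)


section \<open>The triple mixed-spin Ising model\<close>

definition spin_set :: "nat \<Rightarrow> nat list \<Rightarrow> real set" where
  "spin_set k x =
    (if x \<in> gen_class k 0 then {-1/2, 1/2}
     else if x \<in> gen_class k 1 then {-1, 0, 1}
     else {-3/2, -1/2, 1/2, 3/2})"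

definition ball_configs :: "nat \<Rightarrow> nat \<Rightarrow> (nat list \<Rightarrow> real) set" where
  "ball_configs k n = PiE (ball_verts k n) (spin_set k)"

text \<open>For an edge \<open>e = {x, y}\<close> the product over \<open>e\<close> is \<open>\<xi> x * \<xi> y\<close>, since \<open>x \<noteq> y\<close>.\<close>

definition hamiltonian :: "nat \<Rightarrow> real \<Rightarrow> nat \<Rightarrow> (nat list \<Rightarrow> real) \<Rightarrow> real" where
  "hamiltonian k J n \<xi> = - J * (\<Sum>e\<in>ball_edges k n. \<Prod>x\<in>e. \<xi> x)"

text \<open>A boundary field is \<open>h :: nat list \<Rightarrow> real \<Rightarrow> real\<close>, with \<open>h x s\<close> for \<open>h\<^sub>s\<^sub>,\<^sub>x\<close>; only the values
  with \<open>s\<close> in the spin set of \<open>x\<close> matter. The formula for \<open>\<mu>\<^sub>n\<close> also makes sense for \<open>n = 0\<close>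
  (then \<open>V\<^sub>0 = W\<^sub>0\<close> is the root), which is what compatibility at \<open>n = 1\<close> refers to.\<close>

definition gibbs_weight ::
  "nat \<Rightarrow> real \<Rightarrow> real \<Rightarrow> (nat list \<Rightarrow> real \<Rightarrow> real) \<Rightarrow> nat \<Rightarrow> (nat list \<Rightarrow> real) \<Rightarrow> real" where
  "gibbs_weight k J \<beta> h n \<xi> =
     exp (- \<beta> * hamiltonian k J n \<xi> + (\<Sum>x\<in>sphere_verts k n. h x (\<xi> x)))"

definition partition_fun ::
  "nat \<Rightarrow> real \<Rightarrow> real \<Rightarrow> (nat list \<Rightarrow> real \<Rightarrow> real) \<Rightarrow> nat \<Rightarrow> real" where
  "partition_fun k J \<beta> h n = (\<Sum>\<xi>\<in>ball_configs k n. gibbs_weight k J \<beta> h n \<xi>)"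

definition gibbs_mass ::
  "nat \<Rightarrow> real \<Rightarrow> real \<Rightarrow> (nat list \<Rightarrow> real \<Rightarrow> real) \<Rightarrow> nat \<Rightarrow> (nat list \<Rightarrow> real) \<Rightarrow> real" where
  "gibbs_mass k J \<beta> h n \<xi> = gibbs_weight k J \<beta> h n \<xi> / partition_fun k J \<beta> h n"

definition compatible_field ::
  "nat \<Rightarrow> real \<Rightarrow> real \<Rightarrow> (nat list \<Rightarrow> real \<Rightarrow> real) \<Rightarrow> bool" where
  "compatible_field k J \<beta> h \<longleftrightarrow>
     (\<forall>n\<ge>1. \<forall>\<xi>\<in>ball_configs k (n - 1).
        (\<Sum>\<omega>\<in>PiE (sphere_verts k n) (spin_set k).
            gibbs_mass k J \<beta> h n (merge (ball_verts k (n - 1)) (sphere_verts k n) (\<xi>, \<omega>)))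
        = gibbs_mass k J \<beta> h (n - 1) \<xi>)"

definition config_space :: "nat \<Rightarrow> (nat list \<Rightarrow> real) measure" where
  "config_space k = PiM (tree_verts k) (\<lambda>x. count_space (spin_set k x))"

definition splitting_gibbs_measure_for ::
  "nat \<Rightarrow> real \<Rightarrow> real \<Rightarrow> (nat list \<Rightarrow> real \<Rightarrow> real) \<Rightarrow> (nat list \<Rightarrow> real) measure \<Rightarrow> bool" where
  "splitting_gibbs_measure_for k J \<beta> h \<mu> \<longleftrightarrow>
     compatible_field k J \<beta> h \<and> prob_space \<mu> \<and> sets \<mu> = sets (config_space k) \<and>
     (\<forall>n. distr \<mu> (count_space (ball_configs k n)) (\<lambda>\<xi>. restrict \<xi> (ball_verts k n))
          = point_measure (ball_configs k n) (\<lambda>\<xi>. ennreal (gibbs_mass k J \<beta> h n \<xi>)))"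

text \<open>The functions of \<open>x\<close> below are, in order, \<open>X\<close>; \<open>Y\<close>, \<open>Z\<close>; \<open>T\<close>, \<open>U\<close>, \<open>N\<close>.\<close>

definition translation_invariant_field :: "nat \<Rightarrow> (nat list \<Rightarrow> real \<Rightarrow> real) \<Rightarrow> bool" where
  "translation_invariant_field k h \<longleftrightarrow>
     (\<lambda>x. exp (h x (1/2) - h x (-1/2))) constant_on gen_class k 0 \<and>
     (\<lambda>x. exp (h x (-1) - h x 0)) constant_on gen_class k 1 \<and>
     (\<lambda>x. exp (h x 1 - h x 0)) constant_on gen_class k 1 \<and>
     (\<lambda>x. exp (h x (-3/2) - h x (-1/2))) constant_on gen_class k 2 \<and>
     (\<lambda>x. exp (h x (1/2) - h x (-1/2))) constant_on gen_class k 2 \<and>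
     (\<lambda>x. exp (h x (3/2) - h x (-1/2))) constant_on gen_class k 2"

definition TISGM :: "nat \<Rightarrow> real \<Rightarrow> real \<Rightarrow> (nat list \<Rightarrow> real) measure \<Rightarrow> bool" where
  "TISGM k J \<beta> \<mu> \<longleftrightarrow>
     (\<exists>h. translation_invariant_field k h \<and> splitting_gibbs_measure_for k J \<beta> h \<mu>)"

lemma finite_spin_set [simp]: "finite (spin_set k x)"
  and spin_set_nonempty [simp]: "spin_set k x \<noteq> {}"
  by (auto simp: spin_set_def)

lemma finite_ball_configs [simp]: "finite (ball_configs k n)"
  by (simp add: ball_configs_def finite_PiE)

lemma sum_gibbs_mass: "(\<Sum>\<xi>\<in>ball_configs k n. gibbs_mass k J \<beta> h n \<xi>) = 1"
proof -
  have "ball_configs k n \<noteq> {}" by (simp add: ball_configs_def PiE_eq_empty_iff)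
  then have "partition_fun k J \<beta> h n > 0"
    unfolding partition_fun_def by (intro sum_pos) (auto simp: gibbs_weight_def)
  then show ?thesis
    by (simp add: gibbs_mass_def partition_fun_def flip: sum_divide_distrib)
qed

lemma measurable_restrict_ball:
  "(\<lambda>\<xi>. restrict \<xi> (ball_verts k n)) \<in> measurable (config_space k) (count_space (ball_configs k n))"
proof -
  have "ball_verts k n \<subseteq> tree_verts k" by (auto simp: ball_verts_eq)
  then have "(\<lambda>\<xi>. restrict \<xi> (ball_verts k n)) \<in> measurable (config_space k)
     (PiM (ball_verts k n) (\<lambda>x. count_space (spin_set k x)))"
    unfolding config_space_def by (rule measurable_restrict_subset)
  moreover have "PiM (ball_verts k n) (\<lambda>x. count_space (spin_set k x)) = count_space (ball_configs k n)"
    unfolding ball_configs_def by (rule count_space_PiM_finite) (auto intro: countable_finite)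
  ultimately show ?thesis by simp
qed


section \<open>The scalar map\<close>

definition T_map :: "real \<Rightarrow> real \<Rightarrow> nat \<Rightarrow> real" where
  "T_map x \<theta> k = ((x^k + \<theta>^3) / (\<theta>^2 + \<theta> * x^k)) ^ k"

definition U_map :: "real \<Rightarrow> real \<Rightarrow> nat \<Rightarrow> real" where
  "U_map x \<theta> k = ((\<theta> * x^k + 1) / (x^k + \<theta>)) ^ k"

definition N_map :: "real \<Rightarrow> real \<Rightarrow> nat \<Rightarrow> real" where
  "N_map x \<theta> k = ((\<theta>^3 * x^k + 1) / (\<theta>^2 + \<theta> * x^k)) ^ k"

definition p_map :: "real \<Rightarrow> real \<Rightarrow> nat \<Rightarrow> real" where
  "p_map x \<theta> k =
     ((\<theta>^6 * T_map x \<theta> k + \<theta>^4 + \<theta>^2 * U_map x \<theta> k + N_map x \<theta> k)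
      / (\<theta>^3 * (T_map x \<theta> k + 1 + U_map x \<theta> k + N_map x \<theta> k))) ^ k"

definition q_map :: "real \<Rightarrow> real \<Rightarrow> nat \<Rightarrow> real" where
  "q_map x \<theta> k =
     ((T_map x \<theta> k + \<theta>^2 + \<theta>^4 * U_map x \<theta> k + \<theta>^6 * N_map x \<theta> k)
      / (\<theta>^3 * (T_map x \<theta> k + 1 + U_map x \<theta> k + N_map x \<theta> k))) ^ k"

definition f_map :: "real \<Rightarrow> real \<Rightarrow> nat \<Rightarrow> real" where
  "f_map x \<theta> k =
     (p_map x \<theta> k + \<theta> + \<theta>^2 * q_map x \<theta> k) / (\<theta>^2 * p_map x \<theta> k + \<theta> + q_map x \<theta> k)"

definition s_fun :: "nat \<Rightarrow> real \<Rightarrow> real" where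
  "s_fun k \<theta> = deriv (\<lambda>x. f_map x \<theta> k) 1 - 1"

end

theory Submission
  imports Defs
begin

text \<open>
  Everything rests on one repelling fixed point. Spin flip forces \<open>f 1 = 1\<close>, and \<open>s\<^sub>k(\<theta>) > 0\<close> says
  that the slope of \<open>f\<close> there exceeds \<open>1\<close>, so the graph of \<open>f\<close> lies below the diagonal just to the
  left of \<open>1\<close> and above it just to the right. On the other hand \<open>f\<close> takes values strictly between
  \<open>1 / \<theta>\<^sup>2\<close> and \<open>\<theta>\<^sup>2\<close>, so the graph is above the diagonal at \<open>1 / \<theta>\<^sup>2\<close> and below it at \<open>\<theta>\<^sup>2\<close>. The
  intermediate value theorem gives a fixed point on each side of \<open>1\<close>
  (\<open>repelling_fixed_point_flanked\<close>, \<open>three_fixed_points\<close>).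

  Each positive fixed point yields a measure in two steps. Summing out the spins of one generation
  factorises over its vertices, so a boundary field is compatible as soon as a local recursion holds
  at every vertex (\<open>compatible_fieldI\<close>). For a field that depends only on the generation modulo
  three this recursion is the system for \<open>X, Y, Z, T, U, N\<close> (\<open>compatible_level_field\<close>), which a
  fixed point solves. Compatibility in turn makes the finite-volume masses a projective family, and
  Kolmogorov's extension theorem gives the measure (\<open>splitting_gibbs_measure_exists\<close>).

  Finally, the marginal of the measure at the root determines \<open>X = x\<^sup>k\<close>
  (\<open>splitting_gibbs_measure_root_field\<close>), hence \<open>x\<close>, so different fixed points give different
  measures.
\<close>


section \<open>Fixed points of the scalar map\<close>

text \<open>A slope above \<open>1\<close> makes \<open>f x - x\<close> change sign from negative to positive at \<open>a\<close>, while at the ends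
  of the interval it has the opposite signs.\<close>

lemma repelling_fixed_point_flanked:
  fixes f :: "real \<Rightarrow> real"
  assumes fix_a: "f a = a" and deriv_gt: "(f has_real_derivative D) (at a)" "D > 1"
    and cont: "continuous_on {l..u} f"
    and ends: "l < a" "a < u" "l < f l" "f u < u"
  shows "\<exists>b c. l < b \<and> b < a \<and> a < c \<and> c < u \<and> f b = b \<and> f c = c"
proof -
  define g where "g x = f x - x" for x
  have g: "(g has_real_derivative (D - 1)) (at a)"
    unfolding g_def using deriv_gt(1) by (auto intro!: derivative_eq_intros)
  have ga: "g a = 0" using fix_a by (simp add: g_def)
  have g_cont: "continuous_on {l..u} g"
    unfolding g_def by (intro continuous_intros cont)
  obtain d where d: "d > 0" "\<And>h. 0 < h \<Longrightarrow> h < d \<Longrightarrow> 0 < g (a + h)"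
    using DERIV_pos_inc_right[OF g] deriv_gt(2) ga by force
  obtain e where e: "e > 0" "\<And>h. 0 < h \<Longrightarrow> h < e \<Longrightarrow> g (a - h) < 0"
    using DERIV_pos_inc_left[OF g] deriv_gt(2) ga by force
  define h where "h = min d (u - a) / 2"
  have h: "0 < h" "h < d" "a + h < u" using d(1) ends by (auto simp: h_def min_def field_simps)
  define h' where "h' = min e (a - l) / 2"
  have h': "0 < h'" "h' < e" "l < a - h'" using e(1) ends by (auto simp: h'_def min_def field_simps)
  have "\<exists>c\<ge>a + h. c \<le> u \<and> g c = 0"
    using h d(2)[of h] ends g_cont
    by (intro IVT2') (auto simp: g_def intro: continuous_on_subset)
  then obtain c where c: "a + h \<le> c" "c \<le> u" "g c = 0" by blast
  have "\<exists>b\<ge>l. b \<le> a - h' \<and> g b = 0"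
    using h' e(2)[of h'] ends g_cont
    by (intro IVT2') (auto simp: g_def intro: continuous_on_subset)
  then obtain b where b: "l \<le> b" "b \<le> a - h'" "g b = 0" by blast
  have "b \<noteq> l" "c \<noteq> u" using b(3) c(3) ends by (auto simp: g_def)
  with b c h h' show ?thesis
    by (intro exI[of _ b] exI[of _ c]) (auto simp: g_def)
qed

lemma TUN_pos:
  assumes "x > 0" "\<theta> > 0"
  shows "T_map x \<theta> k > 0" "U_map x \<theta> k > 0" "N_map x \<theta> k > 0"
  using assms by (simp_all add: T_map_def U_map_def N_map_def add_pos_pos)

lemma pq_pos:
  assumes "x > 0" "\<theta> > 0"
  shows "p_map x \<theta> k > 0" "q_map x \<theta> k > 0"
  using assms TUN_pos[OF assms, of k]
  by (auto simp: p_map_def q_map_def intro!: zero_less_power divide_pos_pos add_pos_pos mult_pos_pos)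

text \<open>Differentiability at \<open>1\<close> is what makes the value of \<open>deriv\<close> in \<open>s_fun\<close> the slope of the graph;
  continuity elsewhere is needed for the intermediate value theorem.\<close>

lemma f_map_field_differentiable:
  assumes "x > 0" "\<theta> > 0"
  shows "(\<lambda>x. f_map x \<theta> k) field_differentiable (at x)"
proof -
  have nz: "\<theta>^2 + \<theta> * x^k \<noteq> 0" "x^k + \<theta> \<noteq> 0"
    using assms by (auto intro!: less_imp_neq[symmetric] add_pos_pos)
  have TUN: "(\<lambda>x. T_map x \<theta> k) field_differentiable (at x)"
    "(\<lambda>x. U_map x \<theta> k) field_differentiable (at x)"
    "(\<lambda>x. N_map x \<theta> k) field_differentiable (at x)"
    unfolding T_map_def U_map_def N_map_def
    using nz by (auto intro!: derivative_intros)
  have den: "\<theta>^3 * (T_map x \<theta> k + 1 + U_map x \<theta> k + N_map x \<theta> k) \<noteq> 0"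
    using assms TUN_pos[OF assms, of k]
    by (intro less_imp_neq[symmetric] mult_pos_pos add_pos_pos) auto
  have pq: "(\<lambda>x. p_map x \<theta> k) field_differentiable (at x)"
    "(\<lambda>x. q_map x \<theta> k) field_differentiable (at x)"
    unfolding p_map_def q_map_def
    by (intro derivative_intros TUN den)+
  have "\<theta>^2 * p_map x \<theta> k + \<theta> + q_map x \<theta> k > 0"
    using assms pq_pos[OF assms, of k] by (auto intro!: mult_pos_pos add_pos_pos)
  then show ?thesis
    unfolding f_map_def by (intro derivative_intros pq) simp
qed

text \<open>At \<open>x = 1\<close> the spin flip exchanges \<open>T\<close> with \<open>N\<close> and fixes \<open>U = 1\<close>, so \<open>p = q\<close>.\<close>

lemma f_map_1:
  assumes "\<theta> > 0"
  shows "f_map 1 \<theta> k = 1"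
proof -
  have "T_map 1 \<theta> k = N_map 1 \<theta> k" "U_map 1 \<theta> k = 1"
    using assms by (auto simp: T_map_def U_map_def N_map_def add_ac)
  then have "p_map 1 \<theta> k = q_map 1 \<theta> k"
    by (simp add: p_map_def q_map_def algebra_simps)
  moreover have "\<theta>^2 * q_map 1 \<theta> k + \<theta> + q_map 1 \<theta> k > 0"
    using assms pq_pos[of 1 \<theta> k] by (auto intro!: mult_pos_pos add_pos_pos)
  ultimately show ?thesis by (simp add: f_map_def add_ac)
qed

text \<open>\<open>f\<close> is the factor by which one neighbour changes the odds of spin \<open>1/2\<close> against \<open>-1/2\<close>. A
  neighbour of fixed spin \<open>1\<close>, \<open>0\<close> or \<open>-1\<close> would give \<open>\<theta>\<^sup>2\<close>, \<open>1\<close> or \<open>1 / \<theta>\<^sup>2\<close>; \<open>f\<close> is a weighted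
  mean of these with positive weights, hence strictly between the extremes.\<close>

lemma f_map_bounds:
  assumes "x > 0" "\<theta> > 1"
  shows "inverse (\<theta>^2) < f_map x \<theta> k" "f_map x \<theta> k < \<theta>^2"
proof -
  define p q where "p = p_map x \<theta> k" and "q = q_map x \<theta> k"
  have pq: "p > 0" "q > 0" using pq_pos[of x \<theta> k] assms by (auto simp: p_def q_def)
  have t: "\<theta>^2 > 1" "\<theta>^2 * \<theta>^2 > 1" using assms by (auto simp: less_1_mult one_less_power)
  have den: "\<theta>^2 * p + \<theta> + q > 0" using pq assms by (auto intro!: mult_pos_pos add_pos_pos)
  have 1: "1 * q < \<theta>^2 * \<theta>^2 * q" "1 * p < \<theta>^2 * \<theta>^2 * p" "1 * \<theta> < \<theta>^2 * \<theta>"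
    using pq t assms by (auto simp del: mult_1)
  have "\<theta>^2 * p + \<theta> + q < \<theta>^2 * (p + \<theta> + \<theta>^2 * q)" using 1 by (simp add: algebra_simps)
  then show "inverse (\<theta>^2) < f_map x \<theta> k"
    using den t assms by (simp add: f_map_def field_simps flip: p_def q_def)
  have "p + \<theta> + \<theta>^2 * q < \<theta>^2 * (\<theta>^2 * p + \<theta> + q)" using 1 by (simp add: algebra_simps)
  then show "f_map x \<theta> k < \<theta>^2"
    using den by (simp add: f_map_def divide_less_eq flip: p_def q_def)
qed

lemma three_fixed_points:
  assumes "\<theta> > 1" "s_fun k \<theta> > 0"
  shows "\<exists>b c. 0 < b \<and> b < 1 \<and> 1 < c \<and> f_map b \<theta> k = b \<and> f_map c \<theta> k = c"
proof -
  define l where "l = inverse (\<theta>^2)"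
  have l: "0 < l" "l < 1" "1 < \<theta>^2"
    using assms by (auto simp: l_def one_less_power intro!: inverse_less_1_iff[THEN iffD2])
  have "((\<lambda>x. f_map x \<theta> k) has_real_derivative deriv (\<lambda>x. f_map x \<theta> k) 1) (at 1)"
    using f_map_field_differentiable[of 1 \<theta> k] assms
    by (simp add: field_differentiable_derivI)
  moreover have "continuous_on {l..\<theta>^2} (\<lambda>x. f_map x \<theta> k)"
    using l assms
    by (intro continuous_at_imp_continuous_on ballI field_differentiable_imp_continuous_at
          f_map_field_differentiable) auto
  ultimately obtain b c where "l < b" "b < 1" "1 < c" "f_map b \<theta> k = b" "f_map c \<theta> k = c"
    using repelling_fixed_point_flanked[of "\<lambda>x. f_map x \<theta> k" 1 "deriv (\<lambda>x. f_map x \<theta> k) 1" l "\<theta>^2"]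
      f_map_1[of \<theta> k] f_map_bounds[of l \<theta> k] f_map_bounds[of "\<theta>^2" \<theta> k] l assms
    by (auto simp: s_fun_def l_def)
  with l show ?thesis by (intro exI[of _ b] exI[of _ c]) auto
qed


section \<open>Summing out one generation\<close>

lemma sphere_verts_Suc:
  "sphere_verts k (Suc n) = (\<lambda>(x, i). i # x) ` (sphere_verts k n \<times> {..<k})"
  by (force simp: sphere_verts_eq tree_verts_def length_Suc_conv image_iff)

lemma prod_sphere_verts_Suc:
  "(\<Prod>y\<in>sphere_verts k (Suc n). F y) = (\<Prod>x\<in>sphere_verts k n. \<Prod>i<k. F (i # x))"
proof -
  have "inj_on (\<lambda>(x, i). i # x) (sphere_verts k n \<times> {..<k})"
    by (auto simp: inj_on_def)
  then show ?thesis
    unfolding sphere_verts_Suc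
    by (subst prod.reindex) (auto simp: prod.cartesian_product comp_def case_prod_unfold)
qed

lemma ball_edges_Suc:
  "ball_edges k (Suc n) = ball_edges k n \<union> (\<lambda>y. {tl y, y}) ` sphere_verts k (Suc n)"
proof (intro subset_antisym subsetI)
  fix e assume "e \<in> ball_edges k (Suc n)"
  then obtain x i where "e = {x, i # x}" "x \<in> tree_verts k" "i < k" "length x \<le> n"
    by (auto simp: ball_edges_def tree_edges_def ball_verts_eq)
  then have "if length x = n then e = {tl (i # x), i # x} \<and> i # x \<in> sphere_verts k (Suc n)
      else e \<in> ball_edges k n"
    by (auto simp: ball_edges_def tree_edges_def ball_verts_eq sphere_verts_eq tree_verts_def)
  then show "e \<in> ball_edges k n \<union> (\<lambda>y. {tl y, y}) ` sphere_verts k (Suc n)"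
    using image_eqI[of e "\<lambda>y. {tl y, y}" "i # x" "sphere_verts k (Suc n)"]
    by (cases "length x = n") simp_all
next
  fix e assume "e \<in> ball_edges k n \<union> (\<lambda>y. {tl y, y}) ` sphere_verts k (Suc n)"
  then consider "e \<in> ball_edges k n" | y where "e = {tl y, y}" "y \<in> sphere_verts k (Suc n)" by blast
  then show "e \<in> ball_edges k (Suc n)"
  proof cases
    case 1
    then show ?thesis by (force simp: ball_edges_def ball_verts_eq)
  next
    case 2
    then show ?thesis
      by (cases y) (auto simp: ball_edges_def ball_verts_eq sphere_verts_eq tree_edge_iff tree_verts_def)
  qed
qed

lemma finite_ball_edges: "finite (ball_edges k n)"
  by (rule finite_subset[of _ "Pow (ball_verts k n)"]) (auto simp: ball_edges_def)

lemma hamiltonian_Suc: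
  "hamiltonian k J (Suc n) \<eta> =
     hamiltonian k J n \<eta> - J * (\<Sum>y\<in>sphere_verts k (Suc n). \<eta> (tl y) * \<eta> y)"
proof -
  have inj: "inj_on (\<lambda>y. {tl y, y}) (sphere_verts k (Suc n))"
    by (auto simp: inj_on_def doubleton_eq_iff sphere_verts_eq)
  have disj: "ball_edges k n \<inter> (\<lambda>y. {tl y, y}) ` sphere_verts k (Suc n) = {}"
    by (auto simp: ball_edges_def ball_verts_eq sphere_verts_eq)
  have "(\<Prod>x\<in>{tl y, y}. \<eta> x) = \<eta> (tl y) * \<eta> y" if "y \<in> sphere_verts k (Suc n)" for y
  proof -
    have "tl y \<noteq> y" using that by (cases y) (auto simp: sphere_verts_eq)
    then show ?thesis by simp
  qed
  then have "(\<Sum>e\<in>(\<lambda>y. {tl y, y}) ` sphere_verts k (Suc n). \<Prod>x\<in>e. \<eta> x)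
      = (\<Sum>y\<in>sphere_verts k (Suc n). \<eta> (tl y) * \<eta> y)"
    by (simp add: sum.reindex[OF inj])
  then show ?thesis
    unfolding hamiltonian_def ball_edges_Suc
    using sum.union_disjoint[OF finite_ball_edges _ disj, of "\<lambda>e. \<Prod>x\<in>e. \<eta> x"]
    by (simp add: algebra_simps)
qed

text \<open>Every vertex of the outer generation is joined to the ball by the single edge to its parent
  \<open>tl y\<close>. Given the spins inside, the outer spins therefore decouple.\<close>

lemma gibbs_weight_Suc:
  "gibbs_weight k J \<beta> h (Suc n) \<eta> = exp (- \<beta> * hamiltonian k J n \<eta>) *
     (\<Prod>y\<in>sphere_verts k (Suc n). exp (\<beta> * J * \<eta> (tl y) * \<eta> y + h y (\<eta> y)))"
proof -
  have "- \<beta> * hamiltonian k J (Suc n) \<eta> + (\<Sum>y\<in>sphere_verts k (Suc n). h y (\<eta> y)) =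
      - \<beta> * hamiltonian k J n \<eta> +
      (\<Sum>y\<in>sphere_verts k (Suc n). \<beta> * J * \<eta> (tl y) * \<eta> y + h y (\<eta> y))"
    by (simp add: hamiltonian_Suc sum.distrib sum_distrib_left sum_negf algebra_simps)
  then show ?thesis
    by (simp only: gibbs_weight_def exp_add exp_sum finite_sphere_verts)
qed

lemma hamiltonian_cong:
  assumes "\<And>x. x \<in> ball_verts k n \<Longrightarrow> \<eta> x = \<xi> x"
  shows "hamiltonian k J n \<eta> = hamiltonian k J n \<xi>"
  unfolding hamiltonian_def
  by (intro arg_cong2[where f="(*)"] sum.cong prod.cong refl assms) (auto simp: ball_edges_def)

lemma partition_fun_pos: "partition_fun k J \<beta> h n > 0"
proof -
  have "ball_configs k n \<noteq> {}" by (simp add: ball_configs_def PiE_eq_empty_iff)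
  then show ?thesis
    unfolding partition_fun_def by (intro sum_pos) (auto simp: gibbs_weight_def)
qed

lemma gibbs_mass_nonneg: "gibbs_mass k J \<beta> h n \<xi> \<ge> 0"
  using partition_fun_pos[of k J \<beta> h n] by (simp add: gibbs_mass_def gibbs_weight_def)

lemma ball_sphere:
  "ball_verts k n \<inter> sphere_verts k (Suc n) = {}"
  "ball_verts k (Suc n) = ball_verts k n \<union> sphere_verts k (Suc n)"
  by (auto simp: ball_verts_eq sphere_verts_eq)

lemma bij_betw_merge_PiE:
  assumes "I \<inter> J = {}"
  shows "bij_betw (merge I J) (PiE I S \<times> PiE J S) (PiE (I \<union> J) S)"
  using assms
  by (intro bij_betwI[where g="\<lambda>\<eta>. (restrict \<eta> I, restrict \<eta> J)"])
     (auto simp: PiE_cancel_merge PiE_restrict merge_restrict restrict_PiE_iff)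

text \<open>The hypothesis is the standard compatibility criterion, with a free normalising constant \<open>c x\<close> at
  each vertex. Summing the weight over the outer generation turns the boundary term at each \<open>x\<close> of
  the previous generation into \<open>c x\<close> times the old one. The product of the \<open>c x\<close> is independent of
  the configuration, hence is also the ratio of the partition functions and cancels.\<close>

lemma compatible_fieldI:
  assumes pos: "\<And>x. x \<in> tree_verts k \<Longrightarrow> c x > 0"
    and rec: "\<And>x t. x \<in> tree_verts k \<Longrightarrow> t \<in> spin_set k x \<Longrightarrow>
      (\<Prod>i<k. \<Sum>s\<in>spin_set k (i # x). exp (\<beta> * J * t * s + h (i # x) s)) = c x * exp (h x t)"
  shows "compatible_field k J \<beta> h"
proof -
  define C where "C n = (\<Prod>x\<in>sphere_verts k n. c x)" for n
  have C_pos: "C n > 0" for n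
    unfolding C_def by (intro prod_pos) (auto simp: sphere_verts_eq pos)
  have ext: "(\<Sum>\<omega>\<in>PiE (sphere_verts k (Suc n)) (spin_set k).
        gibbs_weight k J \<beta> h (Suc n) (merge (ball_verts k n) (sphere_verts k (Suc n)) (\<xi>, \<omega>)))
      = C n * gibbs_weight k J \<beta> h n \<xi>" (is "?l = _")
    if \<xi>: "\<xi> \<in> ball_configs k n" for n \<xi>
  proof -
    let ?W = "sphere_verts k (Suc n)"
    have weight: "gibbs_weight k J \<beta> h (Suc n) (merge (ball_verts k n) ?W (\<xi>, \<omega>)) =
      exp (- \<beta> * hamiltonian k J n \<xi>) * (\<Prod>y\<in>?W. exp (\<beta> * J * \<xi> (tl y) * \<omega> y + h y (\<omega> y)))"
      for \<omega>
    proof -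
      have "hamiltonian k J n (merge (ball_verts k n) ?W (\<xi>, \<omega>)) = hamiltonian k J n \<xi>"
        by (rule hamiltonian_cong) (simp add: merge_def)
      moreover have "merge (ball_verts k n) ?W (\<xi>, \<omega>) (tl y) = \<xi> (tl y)"
        "merge (ball_verts k n) ?W (\<xi>, \<omega>) y = \<omega> y" if "y \<in> ?W" for y
      proof -
        have "y \<notin> ball_verts k n" "tl y \<in> ball_verts k n"
          using that by (cases y; simp add: ball_verts_eq sphere_verts_eq tree_verts_def)+
        then show "merge (ball_verts k n) ?W (\<xi>, \<omega>) (tl y) = \<xi> (tl y)"
          "merge (ball_verts k n) ?W (\<xi>, \<omega>) y = \<omega> y"
          using that by (simp_all add: merge_def)
      qed
      ultimately show ?thesis by (simp add: gibbs_weight_Suc)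
    qed
    have "?l = exp (- \<beta> * hamiltonian k J n \<xi>) *
        (\<Sum>\<omega>\<in>PiE ?W (spin_set k). \<Prod>y\<in>?W. exp (\<beta> * J * \<xi> (tl y) * \<omega> y + h y (\<omega> y)))"
      unfolding weight by (simp add: sum_distrib_left)
    also have "(\<Sum>\<omega>\<in>PiE ?W (spin_set k). \<Prod>y\<in>?W. exp (\<beta> * J * \<xi> (tl y) * \<omega> y + h y (\<omega> y)))
       = (\<Prod>y\<in>?W. \<Sum>s\<in>spin_set k y. exp (\<beta> * J * \<xi> (tl y) * s + h y s))"
      by (rule prod_sum_PiE[symmetric]) auto
    also have "\<dots> = (\<Prod>x\<in>sphere_verts k n. c x * exp (h x (\<xi> x)))"
      unfolding prod_sphere_verts_Suc list.sel
      using \<xi> by (intro prod.cong refl rec) (auto simp: sphere_verts_eq ball_configs_def ball_verts_eq)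
    also have "\<dots> = C n * exp (\<Sum>x\<in>sphere_verts k n. h x (\<xi> x))"
      by (simp add: C_def prod.distrib exp_sum)
    also have "exp (- \<beta> * hamiltonian k J n \<xi>) * (C n * exp (\<Sum>x\<in>sphere_verts k n. h x (\<xi> x)))
        = C n * gibbs_weight k J \<beta> h n \<xi>"
      by (simp only: gibbs_weight_def exp_add mult_ac)
    finally show ?thesis .
  qed
  have Z: "partition_fun k J \<beta> h (Suc n) = C n * partition_fun k J \<beta> h n" for n
  proof -
    have "partition_fun k J \<beta> h (Suc n) =
      (\<Sum>\<xi>\<in>ball_configs k n. \<Sum>\<omega>\<in>PiE (sphere_verts k (Suc n)) (spin_set k).
        gibbs_weight k J \<beta> h (Suc n) (merge (ball_verts k n) (sphere_verts k (Suc n)) (\<xi>, \<omega>)))"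
      unfolding partition_fun_def ball_configs_def ball_sphere(2)
      by (subst sum.reindex_bij_betw[OF bij_betw_merge_PiE[OF ball_sphere(1)], symmetric])
         (simp add: sum.cartesian_product)
    also have "\<dots> = (\<Sum>\<xi>\<in>ball_configs k n. C n * gibbs_weight k J \<beta> h n \<xi>)"
      by (intro sum.cong refl ext)
    finally show ?thesis by (simp add: partition_fun_def sum_distrib_left)
  qed
  show ?thesis
    unfolding compatible_field_def
  proof (intro allI impI ballI)
    fix n :: nat and \<xi> assume n: "1 \<le> n" and \<xi>: "\<xi> \<in> ball_configs k (n - 1)"
    obtain m where m: "n = Suc m" using n by (cases n) auto
    show "(\<Sum>\<omega>\<in>PiE (sphere_verts k n) (spin_set k).
        gibbs_mass k J \<beta> h n (merge (ball_verts k (n - 1)) (sphere_verts k n) (\<xi>, \<omega>)))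
        = gibbs_mass k J \<beta> h (n - 1) \<xi>"
      using ext[of \<xi> m] \<xi> C_pos[of m] partition_fun_pos[of k J \<beta> h m]
      by (simp add: m gibbs_mass_def Z flip: sum_divide_distrib)
  qed
qed


section \<open>Fields depending on the generation modulo three\<close>

text \<open>Only differences of the \<open>h\<^sub>s\<^sub>,\<^sub>x\<close> over \<open>s\<close> enter \<open>X, Y, Z, T, U, N\<close>, so the reference spins \<open>-1/2\<close>, \<open>0\<close> and \<open>-1/2\<close>
  of the three classes can be given the value \<open>0\<close>.\<close>

definition level_field ::
  "real \<Rightarrow> real \<Rightarrow> real \<Rightarrow> real \<Rightarrow> real \<Rightarrow> real \<Rightarrow> nat list \<Rightarrow> real \<Rightarrow> real" where
  "level_field X Y Z T U N x s =
     (if length x mod 3 = 0 then if s = 1/2 then ln X else 0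
      else if length x mod 3 = 1 then if s = -1 then ln Y else if s = 1 then ln Z else 0
      else if s = -3/2 then ln T else if s = 1/2 then ln U else if s = 3/2 then ln N else 0)"

lemma translation_invariant_level_field:
  "translation_invariant_field k (level_field X Y Z T U N)"
  unfolding translation_invariant_field_def constant_on_def
  by (auto simp: level_field_def gen_class_eq)

lemma spin_set_eq:
  assumes "x \<in> tree_verts k"
  shows "spin_set k x = (if length x mod 3 = 0 then {-1/2, 1/2}
     else if length x mod 3 = 1 then {-1, 0, 1} else {-3/2, -1/2, 1/2, 3/2})"
  using assms by (auto simp: spin_set_def gen_class_eq)

text \<open>In each class the recursion for the reference spin fixes the constant of
  \<open>compatible_fieldI\<close>; the recursions for the remaining one, two or three spins are then the
  equations for \<open>X\<close>, for \<open>Y, Z\<close> and for \<open>T, U, N\<close>.\<close>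

lemma compatible_level_field:
  assumes pos: "X > 0" "Y > 0" "Z > 0" "T > 0" "U > 0" "N > 0"
    and \<theta>: "\<theta> = exp (\<beta> * J / 2)"
    and eqs: "X = ((Y + \<theta> + \<theta>^2 * Z) / (\<theta>^2 * Y + \<theta> + Z)) ^ k"
      "Y = ((\<theta>^6 * T + \<theta>^4 + \<theta>^2 * U + N) / (\<theta>^3 * (T + 1 + U + N))) ^ k"
      "Z = ((T + \<theta>^2 + \<theta>^4 * U + \<theta>^6 * N) / (\<theta>^3 * (T + 1 + U + N))) ^ k"
      "T = ((X + \<theta>^3) / (\<theta>^2 + \<theta> * X)) ^ k"
      "U = ((\<theta> * X + 1) / (X + \<theta>)) ^ k"
      "N = ((\<theta>^3 * X + 1) / (\<theta>^2 + \<theta> * X)) ^ k"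
  shows "compatible_field k J \<beta> (level_field X Y Z T U N)"
proof -
  define h where "h = level_field X Y Z T U N"
  \<comment> \<open>products of spins in classes 2 and 0 are odd multiples of 1/4, which is why \<open>\<theta>\<close> needs a square root\<close>
  define r where "r = exp (\<beta> * J / 4)"
  have r: "r > 0" "\<theta> = r^2"
    using exp_of_nat_mult[of 2 "\<beta> * J / 4"] by (simp_all add: r_def \<theta> mult.commute)
  have e: "exp (\<beta> * J * t * s + b) = r powr (4 * t * s) * exp b" for s t b :: real
    by (simp add: r_def powr_def exp_add)
  \<comment> \<open>\<open>A t\<close>, \<open>B t\<close>, \<open>D t\<close>: the one-child sums below a vertex with spin \<open>t\<close> in class 0, 1, 2\<close>
  define A where "A t = Y * r powr (-4 * t) + 1 + Z * r powr (4 * t)" for t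
  define B where
    "B t = T * r powr (-6 * t) + r powr (-2 * t) + U * r powr (2 * t) + N * r powr (6 * t)" for t
  define D where "D t = r powr (-2 * t) + X * r powr (2 * t)" for t
  have child: "(\<Prod>i<k. \<Sum>s\<in>spin_set k (i # x). exp (\<beta> * J * t * s + h (i # x) s)) =
      (if length x mod 3 = 0 then A t else if length x mod 3 = 1 then B t else D t) ^ k"
    if "x \<in> tree_verts k" for x t
  proof -
    have "i # x \<in> tree_verts k" if "i < k" for i
      using that \<open>x \<in> tree_verts k\<close> by (simp add: tree_verts_def)
    then have "(\<Prod>i<k. \<Sum>s\<in>spin_set k (i # x). r powr (4 * t * s) * exp (h (i # x) s)) =
      (\<Prod>i<k. if length x mod 3 = 0 then A t else if length x mod 3 = 1 then B t else D t)"
      using pos r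
      by (intro prod.cong refl)
         (auto simp: spin_set_eq h_def level_field_def mod_Suc A_def B_def D_def)
    then show ?thesis unfolding e by simp
  qed
  \<comment> \<open>the ratio in each equation is a quotient of one-child sums \<open>a / b\<close>, with numerator and
    denominator multiplied by a power \<open>m\<close> of \<open>r\<close> that clears negative exponents\<close>
  have scale: "a ^ k = b ^ k * V"
    if "V = (P / Q) ^ k" "a * m = P" "b * m = Q" "Q \<noteq> 0" for a b m P Q V :: real
  proof -
    have "a = b * (P / Q)" using that by auto
    then show ?thesis using that(1) by (simp only: power_mult_distrib)
  qed
  have "\<theta>^2 * Y + \<theta> + Z > 0" "\<theta>^3 * (T + 1 + U + N) > 0" "\<theta>^2 + \<theta> * X > 0" "X + \<theta> > 0"
    using pos r by (auto intro!: add_pos_pos mult_pos_pos)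
  note nz = this[THEN less_imp_neq[symmetric]]
  have pw: "r powr - a = inverse (r powr a)" for a
    by (rule powr_minus)
  have A: "A (1/2) ^ k = A (-1/2) ^ k * X"
    by (rule scale[OF eqs(1) _ _ nz(1), of _ "r^2"])
       (use r in \<open>simp_all add: A_def pw field_simps flip: power_add power_mult\<close>)
  have B: "B (-1) ^ k = B 0 ^ k * Y" "B 1 ^ k = B 0 ^ k * Z"
    by (rule scale[OF eqs(2) _ _ nz(2), of _ "r^6"] scale[OF eqs(3) _ _ nz(2), of _ "r^6"];
        use r in \<open>simp add: B_def pw field_simps flip: power_add power_mult\<close>)+
  have D: "D (-3/2) ^ k = D (-1/2) ^ k * T" "D (1/2) ^ k = D (-1/2) ^ k * U"
    "D (3/2) ^ k = D (-1/2) ^ k * N"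
    by (rule scale[OF eqs(4) _ _ nz(3), of _ "r^3"] scale[OF eqs(5) _ _ nz(4), of _ r]
          scale[OF eqs(6) _ _ nz(3), of _ "r^3"];
        use r in \<open>simp add: D_def pw field_simps power2_eq_square power3_eq_cube power4_eq_xxxx\<close>)+
  define c where "c x = (if length x mod 3 = 0 then A (-1/2)
      else if length x mod 3 = 1 then B 0 else D (-1/2)) ^ k" for x :: "nat list"
  show ?thesis
    unfolding h_def[symmetric]
  proof (rule compatible_fieldI[where c=c])
    have "A (-1/2) > 0" "B 0 > 0" "D (-1/2) > 0"
      using pos r by (auto simp: A_def B_def D_def intro!: add_pos_pos)
    then show "c x > 0" for x by (simp add: c_def)
    fix x t assume x: "x \<in> tree_verts k" and t: "t \<in> spin_set k x"
    have "(if length x mod 3 = 0 then A t else if length x mod 3 = 1 then B t else D t) ^ k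
        = c x * exp (h x t)"
    proof -
      consider "length x mod 3 = 0" "t = -1/2 \<or> t = 1/2"
        | "length x mod 3 = 1" "t = -1 \<or> t = 0 \<or> t = 1"
        | "length x mod 3 \<noteq> 0" "length x mod 3 \<noteq> 1"
          "t = -3/2 \<or> t = -1/2 \<or> t = 1/2 \<or> t = 3/2"
        using t by (auto simp: spin_set_eq[OF x] split: if_splits)
      then show ?thesis
      proof cases
        case 1
        then show ?thesis
          using pos A by (elim disjE) (simp_all only: c_def h_def level_field_def, simp_all)
      next
        case 2
        then show ?thesis
          using pos B by (elim disjE) (simp_all only: c_def h_def level_field_def, simp_all)
      next
        case 3
        then show ?thesis
          using pos D by (elim disjE) (simp_all only: c_def h_def level_field_def, simp_all)
      qed
    qed
    then show "(\<Prod>i<k. \<Sum>s\<in>spin_set k (i # x). exp (\<beta> * J * t * s + h (i # x) s)) =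
        c x * exp (h x t)"
      unfolding child[OF x] .
  qed
qed


section \<open>Existence of the splitting Gibbs measure\<close>

lemma restrict_ball_configs:
  assumes "\<xi> \<in> ball_configs k m" "n \<le> m"
  shows "restrict \<xi> (ball_verts k n) \<in> ball_configs k n"
proof -
  have "ball_verts k n \<subseteq> ball_verts k m" using assms(2) by (auto simp: ball_verts_eq)
  then show ?thesis
    using assms(1) unfolding ball_configs_def restrict_PiE_iff by (blast dest: PiE_mem)
qed

lemma measurable_restrict_gibbs:
  assumes "n \<le> m"
  shows "(\<lambda>\<xi>. restrict \<xi> (ball_verts k n)) \<in> measurable
    (point_measure (ball_configs k m) g) (count_space (ball_configs k n))"
  unfolding measurable_point_measure_eq1 space_count_space
  by (rule funcsetI) (rule restrict_ball_configs[OF _ assms])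

lemma prob_space_gibbs:
  "prob_space (point_measure (ball_configs k n) (\<lambda>\<xi>. ennreal (gibbs_mass k J \<beta> h n \<xi>)))"
proof
  show "emeasure (point_measure (ball_configs k n) (\<lambda>\<xi>. ennreal (gibbs_mass k J \<beta> h n \<xi>)))
      (space (point_measure (ball_configs k n) (\<lambda>\<xi>. ennreal (gibbs_mass k J \<beta> h n \<xi>)))) = 1"
    by (simp add: space_point_measure emeasure_point_measure_finite sum_ennreal
        sum_gibbs_mass gibbs_mass_nonneg)
qed

text \<open>Compatibility is the case \<open>m = Suc n\<close>: the configurations that restrict to \<open>\<xi>\<close> on the smaller
  ball are exactly the concatenations of \<open>\<xi>\<close> with an outer configuration. For larger \<open>m\<close> one
  generation is removed at a time.\<close>

lemma compatible_field_marginal: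
  assumes comp: "compatible_field k J \<beta> h" and "n \<le> m"
  shows "distr (point_measure (ball_configs k m) (\<lambda>\<xi>. ennreal (gibbs_mass k J \<beta> h m \<xi>)))
      (count_space (ball_configs k n)) (\<lambda>\<xi>. restrict \<xi> (ball_verts k n))
    = point_measure (ball_configs k n) (\<lambda>\<xi>. ennreal (gibbs_mass k J \<beta> h n \<xi>))"
    (is "distr (?P m) _ _ = ?P n")
  using \<open>n \<le> m\<close>
proof (induction m rule: dec_induct)
  case base
  have "distr (?P n) (count_space (ball_configs k n)) (\<lambda>\<xi>. restrict \<xi> (ball_verts k n))
      = distr (?P n) (?P n) (\<lambda>\<xi>. \<xi>)"
    by (intro distr_cong) (auto simp: sets_point_measure space_point_measure ball_configs_def)
  also have "\<dots> = ?P n" by (rule distr_id)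
  finally show ?case .
next
  case (step m)
  have last: "distr (?P (Suc m)) (count_space (ball_configs k m)) (\<lambda>\<xi>. restrict \<xi> (ball_verts k m)) = ?P m"
  proof (rule measure_eqI_finite[where A="ball_configs k m"])
    fix \<xi> assume \<xi>: "\<xi> \<in> ball_configs k m"
    let ?W = "sphere_verts k (Suc m)" and ?m = "merge (ball_verts k m) (sphere_verts k (Suc m))"
    have fibre: "{\<eta> \<in> ball_configs k (Suc m). restrict \<eta> (ball_verts k m) = \<xi>}
        = (\<lambda>\<omega>. ?m (\<xi>, \<omega>)) ` PiE ?W (spin_set k)"
    proof -
      have "ball_configs k (Suc m) = ?m ` (ball_configs k m \<times> PiE ?W (spin_set k))"
        using bij_betw_imp_surj_on[OF bij_betw_merge_PiE[OF ball_sphere(1)], of k m "spin_set k"]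
        by (simp add: ball_configs_def ball_sphere(2))
      moreover have "restrict (?m (\<xi>', \<omega>)) (ball_verts k m) = \<xi>'" if "\<xi>' \<in> ball_configs k m" for \<xi>' \<omega>
        using that unfolding ball_configs_def by (simp add: ball_sphere(1) PiE_restrict)
      ultimately show ?thesis using \<xi> by auto
    qed
    have inj: "inj_on (\<lambda>\<omega>. ?m (\<xi>, \<omega>)) (PiE ?W (spin_set k))"
      using bij_betw_imp_inj_on[OF bij_betw_merge_PiE[OF ball_sphere(1)], of k m "spin_set k"] \<xi>
      by (auto simp: inj_on_def ball_configs_def)
    have "emeasure (distr (?P (Suc m)) (count_space (ball_configs k m))
          (\<lambda>\<xi>. restrict \<xi> (ball_verts k m))) {\<xi>}
        = emeasure (?P (Suc m)) {\<eta> \<in> ball_configs k (Suc m). restrict \<eta> (ball_verts k m) = \<xi>}"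
      using \<xi> by (subst emeasure_distr[OF measurable_restrict_gibbs])
        (auto simp: space_point_measure intro!: arg_cong2[where f=emeasure])
    also have "\<dots> = (\<Sum>\<eta>\<in>{\<eta> \<in> ball_configs k (Suc m). restrict \<eta> (ball_verts k m) = \<xi>}.
        ennreal (gibbs_mass k J \<beta> h (Suc m) \<eta>))"
      by (subst emeasure_point_measure_finite) auto
    also have "\<dots> = ennreal (\<Sum>\<omega>\<in>PiE ?W (spin_set k). gibbs_mass k J \<beta> h (Suc m) (?m (\<xi>, \<omega>)))"
      unfolding fibre sum.reindex[OF inj] by (simp add: sum_ennreal gibbs_mass_nonneg)
    also have "(\<Sum>\<omega>\<in>PiE ?W (spin_set k). gibbs_mass k J \<beta> h (Suc m) (?m (\<xi>, \<omega>))) = gibbs_mass k J \<beta> h m \<xi>"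
      using comp \<xi> unfolding compatible_field_def by (auto dest!: spec[of _ "Suc m"])
    also have "ennreal (gibbs_mass k J \<beta> h m \<xi>) = emeasure (?P m) {\<xi>}"
      using \<xi> by (simp add: emeasure_point_measure_finite)
    finally show "emeasure (distr (?P (Suc m)) (count_space (ball_configs k m))
        (\<lambda>\<xi>. restrict \<xi> (ball_verts k m))) {\<xi>} = emeasure (?P m) {\<xi>}" .
  qed (auto simp: sets_point_measure)
  have "?P n = distr (distr (?P (Suc m)) (count_space (ball_configs k m)) (\<lambda>\<xi>. restrict \<xi> (ball_verts k m)))
     (count_space (ball_configs k n)) (\<lambda>\<xi>. restrict \<xi> (ball_verts k n))"
    unfolding last by (rule step.IH[symmetric])
  also have "\<dots> = distr (?P (Suc m)) (count_space (ball_configs k n))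
      ((\<lambda>\<xi>. restrict \<xi> (ball_verts k n)) \<circ> (\<lambda>\<xi>. restrict \<xi> (ball_verts k m)))"
  proof (rule distr_distr)
    show "(\<lambda>\<xi>. restrict \<xi> (ball_verts k n)) \<in> measurable
        (count_space (ball_configs k m)) (count_space (ball_configs k n))"
      unfolding measurable_count_space_eq1
      by (rule funcsetI) (simp only: space_count_space, rule restrict_ball_configs[OF _ step.hyps(1)])
  qed (rule measurable_restrict_gibbs, simp)
  also have "(\<lambda>\<xi>. restrict \<xi> (ball_verts k n)) \<circ> (\<lambda>\<xi>. restrict \<xi> (ball_verts k m))
      = (\<lambda>\<xi> :: nat list \<Rightarrow> real. restrict \<xi> (ball_verts k n))"
  proof -
    have "ball_verts k m \<inter> ball_verts k n = ball_verts k n"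
      using step.hyps by (auto simp: ball_verts_eq)
    then show ?thesis by (simp add: comp_def restrict_restrict)
  qed
  finally show ?case by (rule sym)
qed

text \<open>The extension theorem is applied with spins as real numbers, since it needs a Polish space common
  to all vertices. The limit is then moved to the product of the spin sets by a map \<open>clamp\<close> that
  fixes all admissible spins; it does not change the marginals, which charge only such spins.\<close>

lemma splitting_gibbs_measure_exists:
  assumes comp: "compatible_field k J \<beta> h"
  shows "\<exists>\<mu>. splitting_gibbs_measure_for k J \<beta> h \<mu>"
proof -
  let ?P = "\<lambda>n. point_measure (ball_configs k n) (\<lambda>\<xi>. ennreal (gibbs_mass k J \<beta> h n \<xi>))"
  let ?B = "\<lambda>I. PiM I (\<lambda>_. borel :: real measure)"
  define r where "r I = Max (insert 0 (length ` I))" for I :: "nat list set"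
  have r: "I \<subseteq> ball_verts k n \<longleftrightarrow> r I \<le> n" if "finite I" "I \<subseteq> tree_verts k" for I n
  proof -
    have "r I \<le> n \<longleftrightarrow> (\<forall>x\<in>I. length x \<le> n)" using that(1) by (simp add: r_def)
    then show ?thesis using that(2) by (auto simp: ball_verts_eq)
  qed
  \<comment> \<open>the law on a finite set \<open>I\<close> is taken from the smallest ball that contains it; by \<open>Q\<close> below any
    larger ball gives the same law\<close>
  define Q where "Q I = distr (?P (r I)) (?B I) (\<lambda>\<xi>. restrict \<xi> I)" for I
  have meas: "(\<lambda>\<xi>. restrict \<xi> I) \<in> measurable (?P n) (?B I)" for I n
    by (rule measurable_point_measure_eq1[THEN iffD2]) (auto simp: space_PiM)
  have Q: "Q I = distr (?P n) (?B I) (\<lambda>\<xi>. restrict \<xi> I)"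
    if "finite I" "I \<subseteq> ball_verts k n" for I n
  proof -
    have "I \<subseteq> tree_verts k" using that by (auto simp: ball_verts_eq)
    then have le: "r I \<le> n" and I: "I \<subseteq> ball_verts k (r I)" using r[of I] that by auto
    have "Q I = distr (distr (?P n) (count_space (ball_configs k (r I)))
        (\<lambda>\<xi>. restrict \<xi> (ball_verts k (r I)))) (?B I) (\<lambda>\<xi>. restrict \<xi> I)"
      unfolding Q_def compatible_field_marginal[OF comp le] ..
    also have "\<dots> = distr (?P n) (?B I)
        ((\<lambda>\<xi>. restrict \<xi> I) \<circ> (\<lambda>\<xi>. restrict \<xi> (ball_verts k (r I))))"
      using restrict_ball_configs[OF _ le]
      by (intro distr_distr) (auto simp: space_PiM)
    also have "(\<lambda>\<xi>. restrict \<xi> I) \<circ> (\<lambda>\<xi>. restrict \<xi> (ball_verts k (r I)))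
        = (\<lambda>\<xi> :: nat list \<Rightarrow> real. restrict \<xi> I)"
      using I by (simp add: comp_def restrict_restrict Int_absorb1)
    finally show ?thesis .
  qed
  interpret polish_projective "tree_verts k" Q
  proof (rule polish_projective.intro, rule projective_family.intro)
    fix I H :: "nat list set" assume IH: "I \<subseteq> H" "finite H" "H \<subseteq> tree_verts k"
    then have H: "H \<subseteq> ball_verts k (r H)" using r[of H] by auto
    have "distr (Q H) (?B I) (\<lambda>\<xi>. restrict \<xi> I)
        = distr (?P (r H)) (?B I) ((\<lambda>\<xi>. restrict \<xi> I) \<circ> (\<lambda>\<xi>. restrict \<xi> H))"
      unfolding Q_def by (intro distr_distr measurable_restrict_subset IH meas)
    also have "(\<lambda>\<xi>. restrict \<xi> I) \<circ> (\<lambda>\<xi>. restrict \<xi> H) = (\<lambda>\<xi> :: nat list \<Rightarrow> real. restrict \<xi> I)"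
      using IH(1) by (simp add: comp_def restrict_restrict Int_absorb1)
    also have "distr (?P (r H)) (?B I) (\<lambda>\<xi>. restrict \<xi> I) = Q I"
      using IH H by (intro Q[symmetric]) (auto intro: finite_subset)
    finally show "Q I = distr (Q H) (?B I) (\<lambda>\<xi>. restrict \<xi> I)" ..
  next
    fix I :: "nat list set"
    show "prob_space (Q I)"
      unfolding Q_def by (intro prob_space.prob_space_distr prob_space_gibbs meas)
  qed
  define clamp where "clamp x s = (if s \<in> spin_set k x then s else SOME s. s \<in> spin_set k x)" for x s
  have clamp_in: "clamp x s \<in> spin_set k x" for x s
    using some_in_eq[of "spin_set k x"] by (auto simp: clamp_def)
  have clamp_meas: "clamp x \<in> measurable borel (count_space (spin_set k x))" for x
  proof (rule measurable_count_space_eq2[THEN iffD2], simp, intro conjI ballI)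
    show "clamp x \<in> space borel \<rightarrow> spin_set k x" using clamp_in by auto
    fix s
    have "spin_set k x \<in> sets borel" "{s} \<in> sets (borel :: real measure)"
      by (simp_all add: borel_closed finite_imp_closed)
    moreover have "clamp x -` {s} \<inter> space borel = (if s \<in> spin_set k x then
        (if s = (SOME s. s \<in> spin_set k x) then {s} \<union> - spin_set k x else {s})
        else if s = (SOME s. s \<in> spin_set k x) then - spin_set k x else {})"
      by (auto simp: clamp_def split: if_splits)
    ultimately show "clamp x -` {s} \<inter> space borel \<in> sets borel" by auto
  qed
  let ?C = "\<lambda>I \<xi>. \<lambda>x\<in>I. clamp x (\<xi> x)"
  have C_meas: "?C I \<in> measurable (?B I) (PiM I (\<lambda>x. count_space (spin_set k x)))" for I
    by (intro measurable_restrict measurable_compose[OF _ clamp_meas] measurable_component_singleton)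
  define \<mu> where "\<mu> = distr lim (config_space k) (?C (tree_verts k))"
  have lim_meas: "?C (tree_verts k) \<in> measurable lim (config_space k)"
    using C_meas[of "tree_verts k"] unfolding config_space_def
    by (simp cong: measurable_cong_sets)
  have marginal: "distr \<mu> (count_space (ball_configs k n)) (\<lambda>\<xi>. restrict \<xi> (ball_verts k n)) = ?P n" for n
  proof -
    let ?V = "ball_verts k n"
    have V: "?V \<subseteq> tree_verts k" by (auto simp: ball_verts_eq)
    have PiM_V: "PiM ?V (\<lambda>x. count_space (spin_set k x)) = count_space (ball_configs k n)"
      unfolding ball_configs_def by (rule count_space_PiM_finite) (auto intro: countable_finite)
    have restr: "(\<lambda>\<xi>. restrict \<xi> ?V) \<in> measurable lim (?B ?V)"
      using measurable_restrict_subset[OF V, of "\<lambda>_. borel"] by (simp cong: measurable_cong_sets)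
    have "distr lim (?B ?V) (\<lambda>\<xi>. restrict \<xi> ?V) = Q ?V"
    proof (rule measure_eqI)
      show "sets (distr lim (?B ?V) (\<lambda>\<xi>. restrict \<xi> ?V)) = sets (Q ?V)" by (simp add: Q_def)
      fix A assume "A \<in> sets (distr lim (?B ?V) (\<lambda>\<xi>. restrict \<xi> ?V))"
      then have A: "A \<in> sets (?B ?V)" by simp
      have "emeasure (distr lim (?B ?V) (\<lambda>\<xi>. restrict \<xi> ?V)) A
          = emeasure lim (prod_emb (tree_verts k) (\<lambda>_. borel) ?V A)"
        using A restr by (subst emeasure_distr) (auto simp: prod_emb_def space_PiM)
      also have "\<dots> = emeasure (Q ?V) A" by (rule emeasure_lim_emb[OF V _ A]) simp
      finally show "emeasure (distr lim (?B ?V) (\<lambda>\<xi>. restrict \<xi> ?V)) A = emeasure (Q ?V) A" .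
    qed
    also have "\<dots> = distr (?P n) (?B ?V) (\<lambda>\<xi>. restrict \<xi> ?V)" by (rule Q) auto
    finally have lim_V: "distr lim (?B ?V) (\<lambda>\<xi>. restrict \<xi> ?V) = distr (?P n) (?B ?V) (\<lambda>\<xi>. restrict \<xi> ?V)" .
    have "distr \<mu> (count_space (ball_configs k n)) (\<lambda>\<xi>. restrict \<xi> ?V)
        = distr lim (count_space (ball_configs k n)) ((\<lambda>\<xi>. restrict \<xi> ?V) \<circ> ?C (tree_verts k))"
      unfolding \<mu>_def by (rule distr_distr[OF measurable_restrict_ball lim_meas])
    also have "(\<lambda>\<xi>. restrict \<xi> ?V) \<circ> ?C (tree_verts k) = ?C ?V \<circ> (\<lambda>\<xi>. restrict \<xi> ?V)"
      using V by (auto simp: fun_eq_iff restrict_def)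
    also have "distr lim (count_space (ball_configs k n)) (?C ?V \<circ> (\<lambda>\<xi>. restrict \<xi> ?V))
        = distr (distr lim (?B ?V) (\<lambda>\<xi>. restrict \<xi> ?V)) (count_space (ball_configs k n)) (?C ?V)"
      using distr_distr[OF C_meas restr] unfolding PiM_V by (rule sym)
    also have "\<dots> = distr (?P n) (count_space (ball_configs k n)) (?C ?V \<circ> (\<lambda>\<xi>. restrict \<xi> ?V))"
      using distr_distr[OF C_meas[of ?V] meas] unfolding PiM_V lim_V .
    also have "\<dots> = distr (?P n) (?P n) (\<lambda>\<xi>. \<xi>)"
    proof (intro distr_cong)
      fix \<xi> assume "\<xi> \<in> space (?P n)"
      then have "\<xi> \<in> PiE ?V (spin_set k)" by (simp add: space_point_measure ball_configs_def)
      then show "(?C ?V \<circ> (\<lambda>\<xi>. restrict \<xi> ?V)) \<xi> = \<xi>"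
        by (fastforce simp: fun_eq_iff clamp_def PiE_iff extensional_def)
    qed (auto simp: sets_point_measure)
    also have "\<dots> = ?P n" by (rule distr_id)
    finally show ?thesis .
  qed
  have "prob_space \<mu>" unfolding \<mu>_def by (rule P.prob_space_distr[OF lim_meas])
  then have "splitting_gibbs_measure_for k J \<beta> h \<mu>"
    unfolding splitting_gibbs_measure_for_def using comp marginal by (simp add: \<mu>_def)
  then show ?thesis ..
qed


section \<open>The root marginal\<close>

text \<open>The ball of radius \<open>0\<close> has no edges, so the root carries the two spins with odds \<open>exp\<close> of the
  difference of the field.\<close>

lemma splitting_gibbs_measure_root_field:
  assumes "splitting_gibbs_measure_for k J \<beta> h \<mu>" "splitting_gibbs_measure_for k J \<beta> h' \<mu>"
  shows "h [] (1/2) - h [] (-1/2) = h' [] (1/2) - h' [] (-1/2)"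
proof -
  have root: "ball_verts k 0 = {[]}" "sphere_verts k 0 = {[]}" "ball_edges k 0 = {}"
    by (auto simp: ball_verts_eq sphere_verts_eq ball_edges_def tree_edges_def tree_verts_def)
  have marginal: "point_measure (ball_configs k 0) (\<lambda>\<xi>. ennreal (gibbs_mass k J \<beta> h 0 \<xi>))
      = point_measure (ball_configs k 0) (\<lambda>\<xi>. ennreal (gibbs_mass k J \<beta> h' 0 \<xi>))"
    using assms unfolding splitting_gibbs_measure_for_def by metis
  have mass_eq: "gibbs_mass k J \<beta> h 0 \<xi> = gibbs_mass k J \<beta> h' 0 \<xi>" if "\<xi> \<in> ball_configs k 0" for \<xi>
    using arg_cong[OF marginal, of "\<lambda>M. emeasure M {\<xi>}"] that
    by (simp add: gibbs_mass_nonneg emeasure_point_measure_finite)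
  define \<xi> where "\<xi> s = (\<lambda>x :: nat list. if x = [] then s else undefined)" for s :: real
  have \<xi>_in: "\<xi> s \<in> ball_configs k 0" if "s = 1/2 \<or> s = -1/2" for s
    unfolding ball_configs_def root
    by (rule PiE_I) (use that in \<open>auto simp: \<xi>_def spin_set_def gen_class_eq tree_verts_def\<close>)
  have ratio: "gibbs_mass k J \<beta> g 0 (\<xi> (1/2)) / gibbs_mass k J \<beta> g 0 (\<xi> (-1/2))
      = exp (g [] (1/2) - g [] (-1/2))" for g
    using partition_fun_pos[of k J \<beta> g 0]
    by (simp add: gibbs_mass_def gibbs_weight_def hamiltonian_def root exp_diff \<xi>_def)
  have "exp (h [] (1/2) - h [] (-1/2)) = exp (h' [] (1/2) - h' [] (-1/2))"
    unfolding ratio[symmetric] by (simp add: mass_eq \<xi>_in)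
  then show ?thesis by simp
qed


section \<open>Three measures from three fixed points\<close>

definition fixed_point_field :: "nat \<Rightarrow> real \<Rightarrow> real \<Rightarrow> nat list \<Rightarrow> real \<Rightarrow> real" where
  "fixed_point_field k \<theta> x = level_field (x ^ k) (p_map x \<theta> k) (q_map x \<theta> k)
     (T_map x \<theta> k) (U_map x \<theta> k) (N_map x \<theta> k)"

lemma compatible_fixed_point_field:
  assumes "x > 0" "f_map x \<theta> k = x" "\<theta> = exp (\<beta> * J / 2)"
  shows "compatible_field k J \<beta> (fixed_point_field k \<theta> x)"
  unfolding fixed_point_field_def
proof (rule compatible_level_field[OF _ _ _ _ _ _ assms(3)])
  have "\<theta> > 0" by (simp add: assms(3))
  then show "x ^ k > 0" "p_map x \<theta> k > 0" "q_map x \<theta> k > 0"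
    "T_map x \<theta> k > 0" "U_map x \<theta> k > 0" "N_map x \<theta> k > 0"
    using assms(1) TUN_pos pq_pos by auto
  show "x ^ k = ((p_map x \<theta> k + \<theta> + \<theta>^2 * q_map x \<theta> k) /
      (\<theta>^2 * p_map x \<theta> k + \<theta> + q_map x \<theta> k)) ^ k"
    using assms(2) by (simp add: f_map_def)
qed (simp_all only: p_map_def q_map_def T_map_def U_map_def N_map_def)

lemma fixed_point_field_root:
  "fixed_point_field k \<theta> x [] (1/2) - fixed_point_field k \<theta> x [] (-1/2) = ln (x ^ k)"
  by (simp add: fixed_point_field_def level_field_def)

theorem theorem1:
  fixes k :: nat and J \<beta> \<theta> :: real
  assumes "k \<ge> 2" and "J > 0" and "\<beta> > 0"
    and "\<theta> = exp (\<beta> * J / 2)"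
    and "s_fun k \<theta> > 0"
  shows "(\<exists>A. A \<subseteq> {x. x > 0 \<and> x = f_map x \<theta> k} \<and> card A = 3) \<and>
         (\<exists>M. M \<subseteq> {\<mu>. TISGM k J \<beta> \<mu>} \<and> card M = 3)"
proof -
  have "\<theta> > 1" using assms by simp
  then obtain b c where bc: "0 < b" "b < 1" "1 < c" "f_map b \<theta> k = b" "f_map c \<theta> k = c"
    using three_fixed_points assms(5) by blast
  define A where "A = {b, 1, c}"
  have card_A: "card A = 3" using bc by (simp add: A_def)
  have A: "x > 0" "f_map x \<theta> k = x" if "x \<in> A" for x
    using that bc f_map_1[of \<theta> k] \<open>\<theta> > 1\<close> by (auto simp: A_def)
  have "\<forall>x\<in>A. \<exists>\<mu>. splitting_gibbs_measure_for k J \<beta> (fixed_point_field k \<theta> x) \<mu>"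
    using A compatible_fixed_point_field[OF _ _ assms(4)] splitting_gibbs_measure_exists by blast
  then obtain \<mu> where \<mu>:
    "\<And>x. x \<in> A \<Longrightarrow> splitting_gibbs_measure_for k J \<beta> (fixed_point_field k \<theta> x) (\<mu> x)"
    by metis
  have "inj_on \<mu> A"
  proof (rule inj_onI)
    fix x y assume xy: "x \<in> A" "y \<in> A" "\<mu> x = \<mu> y"
    have "ln (x ^ k) = ln (y ^ k)"
      using splitting_gibbs_measure_root_field[OF \<mu>[OF xy(1)]] \<mu>[OF xy(2)] xy(3)
      by (metis fixed_point_field_root)
    then have "x ^ k = y ^ k" using A xy by simp
    then show "x = y"
      using A[OF xy(1)] A[OF xy(2)] assms(1) by (intro power_eq_imp_eq_base[of x k y]) auto
  qed
  then have "card (\<mu> ` A) = 3" by (simp add: card_image card_A)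
  moreover have "TISGM k J \<beta> (\<mu> x)" if "x \<in> A" for x
    using \<mu>[OF that] translation_invariant_level_field
    unfolding TISGM_def fixed_point_field_def by blast
  ultimately show ?thesis
    using card_A A by (intro conjI exI[of _ A] exI[of _ "\<mu> ` A"]) auto
qed

end
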